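(* Let $F$ be a field. Then there exists a noncommutative division ring $D$ with center $F$ such that $D$ is infinite-dimensional over $F$, every element of $D$ can be written as a product of two commutators in $D$, and every nonzero element of $D$ can be written as a product of two noncentral commutators in $D$.
   Context: A commutator in $D$ is an element $[a,b]=ab-ba$ with $a,b\in D$. It is noncentral if it does not belong to the center of $D$. "With center $F$" means that the center of $D$ is (isomorphic to) $F$. *)

theory Defs
  imports "HOL-Algebra.Algebra"
begin

locale division_ring = ring +
  assumes one_not_zero: "\<one> \<noteq> \<zero>"
    and division_ring_Units: "Units R = carrier R - {\<zero>}"

definition ring_center :: "('a, 'm) ring_scheme \<Rightarrow> 'a set"
  where "ring_center R =
    {z \<in> carrier R. \<forall>x\<in>carrier R. z \<otimes>\<^bsub>R\<^esub> x = x \<otimes>\<^bsub>R\<^esub> z}"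

(* Single commutators only: neither the additive span nor the ideal they generate. *)
definition ring_commutators :: "('a, 'm) ring_scheme \<Rightarrow> 'a set"
  where "ring_commutators R =
    {(a \<otimes>\<^bsub>R\<^esub> b) \<ominus>\<^bsub>R\<^esub> (b \<otimes>\<^bsub>R\<^esub> a) | a b. a \<in> carrier R \<and> b \<in> carrier R}"

(* The center is a subfield, so the dimension theory of HOL-Algebra (over a subfield
   of a possibly noncommutative ring, acting by left multiplication) applies over it. *)
lemma (in division_ring) ring_center_subfield: "subfield (ring_center R) R"
proof -
  let ?Z = "ring_center R"
  have cl: "z \<in> carrier R" if "z \<in> ?Z" for z
    using that unfolding ring_center_def by blast
  have comm: "z \<otimes> x = x \<otimes> z" if "z \<in> ?Z" "x \<in> carrier R" for z x
    using that unfolding ring_center_def by blast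
  have ZI: "z \<in> ?Z" if "z \<in> carrier R" "\<And>x. x \<in> carrier R \<Longrightarrow> z \<otimes> x = x \<otimes> z" for z
    using that unfolding ring_center_def by blast
  have sr: "subring ?Z R"
  proof (rule subringI)
    show "?Z \<subseteq> carrier R" using cl by blast
    show "\<one> \<in> ?Z" by (rule ZI) simp_all
  next
    fix h assume h: "h \<in> ?Z"
    show "\<ominus> h \<in> ?Z"
      by (rule ZI) (simp_all add: cl[OF h] l_minus r_minus comm[OF h])
  next
    fix h1 h2 assume h: "h1 \<in> ?Z" "h2 \<in> ?Z"
    note c = cl[OF h(1)] cl[OF h(2)]
    show "h1 \<oplus> h2 \<in> ?Z"
      by (rule ZI) (simp_all add: c l_distr r_distr comm[OF h(1)] comm[OF h(2)])
    show "h1 \<otimes> h2 \<in> ?Z"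
    proof (rule ZI)
      fix x assume x: "x \<in> carrier R"
      have "h1 \<otimes> h2 \<otimes> x = h1 \<otimes> (h2 \<otimes> x)" using c x by (rule m_assoc)
      also have "\<dots> = h1 \<otimes> (x \<otimes> h2)" by (simp only: comm[OF h(2) x])
      also have "\<dots> = h1 \<otimes> x \<otimes> h2" by (rule m_assoc[OF c(1) x c(2), symmetric])
      also have "\<dots> = x \<otimes> h1 \<otimes> h2" by (simp only: comm[OF h(1) x])
      also have "\<dots> = x \<otimes> (h1 \<otimes> h2)" using x c by (rule m_assoc)
      finally show "h1 \<otimes> h2 \<otimes> x = x \<otimes> (h1 \<otimes> h2)" .
    qed (simp add: c)
  qed
  have unit: "k \<in> Units (R\<lparr>carrier := ?Z\<rparr>)" if k: "k \<in> ?Z" "k \<noteq> \<zero>" for k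
  proof -
    have u: "k \<in> Units R" using cl[OF k(1)] k(2) division_ring_Units by blast
    note kc = cl[OF k(1)]
    have ic: "inv k \<in> carrier R" using u by (rule Units_inv_closed)
    have i: "inv k \<otimes> k = \<one>" "k \<otimes> inv k = \<one>"
      using u by (rule Units_l_inv, rule Units_r_inv)
    have "inv k \<in> ?Z"
    proof (rule ZI[OF ic])
      fix x assume x: "x \<in> carrier R"
      have "inv k \<otimes> x = inv k \<otimes> (x \<otimes> (k \<otimes> inv k))" using x by (simp add: i)
      also have "\<dots> = inv k \<otimes> ((x \<otimes> k) \<otimes> inv k)" by (simp only: m_assoc[OF x kc ic])
      also have "\<dots> = inv k \<otimes> ((k \<otimes> x) \<otimes> inv k)" by (simp only: comm[OF k(1) x])
      also have "\<dots> = (inv k \<otimes> k) \<otimes> (x \<otimes> inv k)" using ic kc x by (simp add: m_assoc)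
      also have "\<dots> = x \<otimes> inv k" using ic x by (simp add: i)
      finally show "inv k \<otimes> x = x \<otimes> inv k" .
    qed
    then show ?thesis unfolding Units_def using k(1) i by auto
  qed
  have zero: "\<zero> \<notin> Units (R\<lparr>carrier := ?Z\<rparr>)"
    using one_not_zero cl unfolding Units_def by fastforce
  show ?thesis
  proof (rule subfieldI)
    show "subcring ?Z R"
      using sr comm cl by (blast intro: subcringI)
    show "Units (R\<lparr>carrier := ?Z\<rparr>) = ?Z - {\<zero>}"
      using unit zero unfolding Units_def by auto
  qed
qed

end

theory Submission
  imports Defs "HOL-Library.Countable"
begin

text \<open>
  Let \<open>K\<close> be the field of Puiseux-type series over \<open>F\<close>: formal sums of \<open>a\<^sub>q x\<^sup>q\<close> over rational
  exponents \<open>q\<close> that are bounded below and have a common denominator. The substitution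
  \<open>x \<mapsto> x\<^sup>2\<close> is an automorphism \<open>\<sigma>\<close> of \<open>K\<close> with fixed field \<open>F\<close>, in every characteristic and also for
  finite \<open>F\<close>: the support of a fixed series is closed under doubling and halving, and a least
  nonzero exponent contradicts this. Let \<open>D = K((t; \<sigma>))\<close> be the division ring of twisted Laurent
  series, with \<open>t a = \<sigma>(a) t\<close>.

  Comparing coefficients in \<open>[x, \<Sum> b\<^sub>k t\<^sup>k] = \<Sum> (x - \<sigma>\<^sup>k(x)) b\<^sub>k t\<^sup>k\<close>, where
  \<open>x \<noteq> \<sigma>\<^sup>k(x)\<close> for \<open>k \<noteq> 0\<close>, shows that a central element lies in \<open>K\<close>, hence in \<open>F\<close>, and that every
  series with vanishing constant coefficient is a commutator. A nonzero \<open>f\<close> is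
  \<open>(f t\<^sup>-\<^sup>j) t\<^sup>j\<close>; taking \<open>j \<noteq> 0\<close> below the order of \<open>f\<close> makes both factors noncentral with
  vanishing constant coefficient.
\<close>

section \<open>Twisted series rings\<close>

definition support :: "('r, 'm) ring_scheme \<Rightarrow> ('g \<Rightarrow> 'r) \<Rightarrow> 'g set"
  where "support R f = {i. f i \<noteq> \<zero>\<^bsub>R\<^esub>}"

text \<open>The product of formal sums of \<open>f i\<close> t^i under the rule t^i a =
  \<open>\<sigma> i a\<close> t^i. The index set keeps only pairs of nonzero coefficients, because a
  \<open>finsum\<close> over an infinite set has just a default value.\<close>

definition twisted_conv ::
    "('r, 'm) ring_scheme \<Rightarrow> ('g::ab_group_add \<Rightarrow> 'r \<Rightarrow> 'r) \<Rightarrow> ('g \<Rightarrow> 'r) \<Rightarrow> ('g \<Rightarrow> 'r) \<Rightarrow> 'g \<Rightarrow> 'r"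
  where "twisted_conv R \<sigma> f g k =
    (\<Oplus>\<^bsub>R\<^esub>i\<in>{i \<in> support R f. k - i \<in> support R g}. f i \<otimes>\<^bsub>R\<^esub> \<sigma> i (g (k - i)))"

definition series_mono :: "('r, 'm) ring_scheme \<Rightarrow> 'r \<Rightarrow> 'g \<Rightarrow> 'g \<Rightarrow> 'r"
  where "series_mono R a m = (\<lambda>k. if k = m then a else \<zero>\<^bsub>R\<^esub>)"

text \<open>Coefficient ring, twist and supports are parameters so that the construction can be
  applied twice: first in x over F, then in t over the result.\<close>

definition series_ring ::
    "('r, 'm) ring_scheme \<Rightarrow> ('g::ab_group_add \<Rightarrow> 'r \<Rightarrow> 'r) \<Rightarrow> 'g set set \<Rightarrow> ('g \<Rightarrow> 'r) ring"
  where "series_ring R \<sigma> \<W> =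
    \<lparr>carrier = {f. (\<forall>i. f i \<in> carrier R) \<and> support R f \<in> \<W>},
     monoid.mult = twisted_conv R \<sigma>,
     monoid.one = series_mono R \<one>\<^bsub>R\<^esub> 0,
     ring.zero = (\<lambda>_. \<zero>\<^bsub>R\<^esub>),
     ring.add = (\<lambda>f g k. f k \<oplus>\<^bsub>R\<^esub> g k)\<rparr>"

text \<open>The right inverse \<open>y\<close> of \<open>x\<close> has a right inverse
  \<open>z\<close> of its own, and x = (x y) z = z makes \<open>y\<close> two-sided. One-sided
  inverses are what solving for the coefficients of a series produces.\<close>

lemma (in ring) division_ringI:
  assumes "\<one> \<noteq> \<zero>" and "\<And>x. x \<in> carrier R \<Longrightarrow> x \<noteq> \<zero> \<Longrightarrow> \<exists>y\<in>carrier R. x \<otimes> y = \<one>"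
  shows "division_ring R"
proof
  show "\<one> \<noteq> \<zero>" by fact
  have "x \<in> Units R" if x: "x \<in> carrier R" "x \<noteq> \<zero>" for x
  proof -
    obtain y where y: "y \<in> carrier R" "x \<otimes> y = \<one>" using assms(2) x by blast
    have "y \<noteq> \<zero>" using y x assms(1) by auto
    then obtain z where z: "z \<in> carrier R" "y \<otimes> z = \<one>" using assms(2) y by blast
    have "x = (x \<otimes> y) \<otimes> z" using x y z m_assoc[of x y z] by simp
    then have "x = z" using y z by simp
    then show ?thesis using x y z unfolding Units_def by auto
  qed
  moreover have "\<zero> \<notin> Units R" using assms(1) unfolding Units_def by auto
  ultimately show "Units R = carrier R - {\<zero>}" by (auto simp: Units_def)
qed

lemma (in abelian_monoid) finsum_swap:
  assumes "finite A" "finite B" "\<And>i j. i \<in> A \<Longrightarrow> j \<in> B \<Longrightarrow> f i j \<in> carrier G"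
  shows "(\<Oplus>i\<in>A. \<Oplus>j\<in>B. f i j) = (\<Oplus>j\<in>B. \<Oplus>i\<in>A. f i j)"
  using assms(1,3)
proof (induction A rule: finite_induct)
  case empty
  then show ?case by simp
next
  case (insert x A)
  then have "(\<Oplus>j\<in>B. \<Oplus>i\<in>insert x A. f i j) = (\<Oplus>j\<in>B. f x j \<oplus> (\<Oplus>i\<in>A. f i j))"
    by (intro finsum_cong') (auto intro!: finsum_closed)
  also have "\<dots> = (\<Oplus>j\<in>B. f x j) \<oplus> (\<Oplus>j\<in>B. \<Oplus>i\<in>A. f i j)"
    using insert by (intro finsum_addf) (auto intro!: finsum_closed)
  finally show ?case using insert by (auto intro!: finsum_closed)
qed

text \<open>
  The index group is not assumed to be discrete, so the admissible supports are a parameter.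
  Local finiteness makes the convolution sums finite and allows recursion on the coefficients; the
  set \<open>M\<close> in the last assumption carries the support of \<open>(1 - y)\<^sup>-\<^sup>1\<close> when \<open>y\<close> is supported in \<open>U\<close>.
\<close>

locale twisted_series = ring R for R (structure) +
  fixes \<sigma> :: "'g::linordered_ab_group_add \<Rightarrow> 'a \<Rightarrow> 'a" and \<W> :: "'g set set"
  assumes twist_hom: "\<sigma> i \<in> ring_hom R R"
    and twist_0: "a \<in> carrier R \<Longrightarrow> \<sigma> 0 a = a"
    and twist_add: "a \<in> carrier R \<Longrightarrow> \<sigma> (i + j) a = \<sigma> i (\<sigma> j a)"
    and supports_subset: "U \<in> \<W> \<Longrightarrow> V \<subseteq> U \<Longrightarrow> V \<in> \<W>"
    and supports_Un: "U \<in> \<W> \<Longrightarrow> V \<in> \<W> \<Longrightarrow> U \<union> V \<in> \<W>"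
    and supports_plus: "U \<in> \<W> \<Longrightarrow> V \<in> \<W> \<Longrightarrow> {s + t |s t. s \<in> U \<and> t \<in> V} \<in> \<W>"
    and supports_singleton: "{i} \<in> \<W>"
    and supports_locally_finite: "U \<in> \<W> \<Longrightarrow> finite {s \<in> U. s \<le> k}"
    and supports_absorb: "U \<in> \<W> \<Longrightarrow> (\<And>s. s \<in> U \<Longrightarrow> 0 < s) \<Longrightarrow>
          \<exists>M\<in>\<W>. 0 \<in> M \<and> (\<forall>s\<in>U. \<forall>m\<in>M. s + m \<in> M)"
begin

abbreviation "D \<equiv> series_ring R \<sigma> \<W>"
abbreviation "supp \<equiv> support R"
abbreviation "conv \<equiv> twisted_conv R \<sigma>"
abbreviation "smono \<equiv> series_mono R"

section \<open>Twists and admissible supports\<close>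

lemma twist_closed [simp]: "a \<in> carrier R \<Longrightarrow> \<sigma> i a \<in> carrier R"
  using ring_hom_memE(1)[OF twist_hom] .

lemma twist_mult: "a \<in> carrier R \<Longrightarrow> b \<in> carrier R \<Longrightarrow> \<sigma> i (a \<otimes> b) = \<sigma> i a \<otimes> \<sigma> i b"
  using ring_hom_memE(2)[OF twist_hom] .

lemma twist_plus: "a \<in> carrier R \<Longrightarrow> b \<in> carrier R \<Longrightarrow> \<sigma> i (a \<oplus> b) = \<sigma> i a \<oplus> \<sigma> i b"
  using ring_hom_memE(3)[OF twist_hom] .

lemma twist_one [simp]: "\<sigma> i \<one> = \<one>"
  using ring_hom_memE(4)[OF twist_hom] .

lemma twist_ring_hom_ring: "ring_hom_ring R R (\<sigma> i)"
  by (intro ring_hom_ringI2 ring_axioms twist_hom)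

lemma twist_zero [simp]: "\<sigma> i \<zero> = \<zero>"
  using ring_hom_zero[OF twist_hom ring_axioms ring_axioms] .

lemma twist_finsum:
  assumes "f \<in> A \<rightarrow> carrier R"
  shows "\<sigma> i (\<Oplus>j\<in>A. f j) = (\<Oplus>j\<in>A. \<sigma> i (f j))"
  using ring_hom_ring.hom_finsum[OF twist_ring_hom_ring assms] by (simp add: comp_def)

text \<open>The part of \<open>U\<close> below any member \<open>s0\<close> is finite and nonempty,
  and its minimum is a minimum of all of \<open>U\<close>. Hence a nonzero series has an order even
  when the index group is dense.\<close>

lemma supports_Min:
  assumes "U \<in> \<W>" "U \<noteq> {}"
  obtains m where "m \<in> U" "\<And>s. s \<in> U \<Longrightarrow> m \<le> s"
proof -
  obtain s0 where s0: "s0 \<in> U" using assms by blast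
  let ?T = "{s \<in> U. s \<le> s0}"
  have fin: "finite ?T" and ne: "?T \<noteq> {}" using supports_locally_finite assms s0 by auto
  have "Min ?T \<in> U" using Min_in[OF fin ne] by simp
  moreover have "Min ?T \<le> s" if "s \<in> U" for s
  proof (cases "s \<le> s0")
    case True
    then show ?thesis using fin that by simp
  next
    case False
    have "Min ?T \<le> s0" using Min_in[OF fin ne] by simp
    then show ?thesis using False by simp
  qed
  ultimately show ?thesis using that by blast
qed

text \<open>A least element \<open>m\<close> of \<open>V\<close> forces
  \<open>i \<le> k - m\<close>, so local finiteness of \<open>U\<close> applies. This makes each
  coefficient of a product a finite sum.\<close>

lemma supports_finite_pairs:
  assumes "U \<in> \<W>" "V \<in> \<W>"
  shows "finite {i \<in> U. k - i \<in> V}"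
proof (cases "V = {}")
  case False
  then obtain m where m: "m \<in> V" "\<And>s. s \<in> V \<Longrightarrow> m \<le> s" using supports_Min assms by blast
  have "{i \<in> U. k - i \<in> V} \<subseteq> {i \<in> U. i \<le> k - m}"
    using m(2) by (force simp: algebra_simps)
  then show ?thesis using supports_locally_finite[OF assms(1)] finite_subset by blast
qed simp

section \<open>Convolution and the ring axioms\<close>

lemma carrier_D: "f \<in> carrier D \<longleftrightarrow> (\<forall>i. f i \<in> carrier R) \<and> supp f \<in> \<W>"
  by (simp add: series_ring_def)

lemma coeff_closed: "f \<in> carrier D \<Longrightarrow> f i \<in> carrier R"
  by (simp add: carrier_D)

lemma supp_in: "f \<in> carrier D \<Longrightarrow> supp f \<in> \<W>"
  by (simp add: carrier_D)

lemma not_supp: "i \<notin> supp f \<Longrightarrow> f i = \<zero>"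
  by (simp add: support_def)

lemma carrier_DI:
  assumes "\<And>i. f i \<in> carrier R" "U \<in> \<W>" "\<And>i. i \<notin> U \<Longrightarrow> f i = \<zero>"
  shows "f \<in> carrier D"
proof -
  have "supp f \<subseteq> U" using assms(3) by (auto simp: support_def)
  then have "supp f \<in> \<W>" using assms(2) supports_subset by blast
  then show ?thesis using assms(1) by (simp add: carrier_D)
qed

lemma mult_D: "f \<otimes>\<^bsub>D\<^esub> g = conv f g"
  by (simp add: series_ring_def)

lemma one_D: "\<one>\<^bsub>D\<^esub> = smono \<one> 0"
  by (simp add: series_ring_def)

lemma zero_D: "\<zero>\<^bsub>D\<^esub> = (\<lambda>_. \<zero>)"
  by (simp add: series_ring_def)

lemma add_D: "f \<oplus>\<^bsub>D\<^esub> g = (\<lambda>k. f k \<oplus> g k)"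
  by (simp add: series_ring_def)

text \<open>Terms outside the supports vanish, so the index set may be enlarged to any finite
  \<open>A\<close>. Sums that come with different supports can thus be brought to a common index
  set.\<close>

lemma conv_eq:
  assumes f: "f \<in> carrier D" and g: "g \<in> carrier D" and A: "finite A"
    "\<And>i. i \<in> supp f \<Longrightarrow> k - i \<in> supp g \<Longrightarrow> i \<in> A"
  shows "conv f g k = (\<Oplus>i\<in>A. f i \<otimes> \<sigma> i (g (k - i)))"
  unfolding twisted_conv_def
proof (rule add.finprod_mono_neutral_cong_left[OF A(1)])
  show "{i \<in> supp f. k - i \<in> supp g} \<subseteq> A" using A by blast
  show "f i \<otimes> \<sigma> i (g (k - i)) = \<zero>" if "i \<in> A - {i \<in> supp f. k - i \<in> supp g}" for i
    using that coeff_closed[OF f] coeff_closed[OF g] by (auto simp: support_def)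
qed (use coeff_closed[OF f] coeff_closed[OF g] in auto)

lemma conv_coeff_closed:
  assumes "f \<in> carrier D" "g \<in> carrier D"
  shows "conv f g k \<in> carrier R"
  unfolding twisted_conv_def using coeff_closed[OF assms(1)] coeff_closed[OF assms(2)]
  by (auto intro!: finsum_closed)

lemma conv_eq_zero:
  assumes f: "f \<in> carrier D" and g: "g \<in> carrier D"
    and "\<And>i. i \<in> supp f \<Longrightarrow> k - i \<notin> supp g"
  shows "conv f g k = \<zero>"
  using conv_eq[OF f g, of "{}" k] assms(3) by auto

lemma conv_closed:
  assumes f: "f \<in> carrier D" and g: "g \<in> carrier D"
  shows "conv f g \<in> carrier D"
proof (rule carrier_DI[OF conv_coeff_closed[OF assms] supports_plus[OF supp_in[OF f] supp_in[OF g]]])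
  fix k assume k: "k \<notin> {s + t |s t. s \<in> supp f \<and> t \<in> supp g}"
  have "k - i \<notin> supp g" if "i \<in> supp f" for i
  proof
    assume "k - i \<in> supp g"
    moreover have "k = i + (k - i)" by simp
    ultimately show False using k that by blast
  qed
  then show "conv f g k = \<zero>" using conv_eq_zero[OF f g] by blast
qed

lemma supp_conv:
  assumes f: "f \<in> carrier D" and g: "g \<in> carrier D" and k: "k \<in> supp (conv f g)"
  shows "\<exists>i\<in>supp f. k - i \<in> supp g"
  using conv_eq_zero[OF f g, of k] k by (auto simp: support_def)

lemma conv_assoc:
  assumes f: "f \<in> carrier D" and g: "g \<in> carrier D" and h: "h \<in> carrier D"
  shows "conv (conv f g) h = conv f (conv g h)"
proof
  fix k
  \<comment> \<open>\<open>P\<close> holds the possible degrees \<open>p = i + j\<close> from the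
    first two factors, and \<open>A\<close> all \<open>i\<close> that occur for some such
    \<open>p\<close>. Neither depends on the other index, so the double sum runs over a finite
    rectangle and its order can be exchanged.\<close>
  define P where "P = {p \<in> {s + t |s t. s \<in> supp f \<and> t \<in> supp g}. k - p \<in> supp h}"
  define A where "A = (\<Union>p\<in>P. {i \<in> supp f. p - i \<in> supp g})"
  note cl = coeff_closed[OF f] coeff_closed[OF g] coeff_closed[OF h]
  have P: "finite P" unfolding P_def
    by (intro supports_finite_pairs supports_plus supp_in f g h)
  have A: "finite A" unfolding A_def
    using P by (intro finite_UN_I supports_finite_pairs supp_in f g) auto
  have fgP: "i + j \<in> P" if "i \<in> supp f" "j \<in> supp g" "k - (i + j) \<in> supp h" for i j
    using that unfolding P_def by blast
  have "conv (conv f g) h k = (\<Oplus>p\<in>P. conv f g p \<otimes> \<sigma> p (h (k - p)))"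
  proof (rule conv_eq[OF conv_closed[OF f g] h P])
    fix p assume p: "p \<in> supp (conv f g)" "k - p \<in> supp h"
    obtain i where i: "i \<in> supp f" "p - i \<in> supp g" using supp_conv[OF f g p(1)] by blast
    show "p \<in> P" using fgP[OF i] p(2) by simp
  qed
  also have "\<dots> = (\<Oplus>p\<in>P. (\<Oplus>i\<in>A. f i \<otimes> \<sigma> i (g (p - i))) \<otimes> \<sigma> p (h (k - p)))"
  proof (rule finsum_cong'[OF refl])
    fix p assume p: "p \<in> P"
    have "conv f g p = (\<Oplus>i\<in>A. f i \<otimes> \<sigma> i (g (p - i)))"
      using p by (intro conv_eq[OF f g A]) (auto simp: A_def)
    then show "conv f g p \<otimes> \<sigma> p (h (k - p)) =
        (\<Oplus>i\<in>A. f i \<otimes> \<sigma> i (g (p - i))) \<otimes> \<sigma> p (h (k - p))" by simp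
  qed (use cl in \<open>auto intro!: finsum_closed\<close>)
  also have "\<dots> = (\<Oplus>p\<in>P. \<Oplus>i\<in>A. f i \<otimes> \<sigma> i (g (p - i)) \<otimes> \<sigma> p (h (k - p)))"
    using A cl by (intro finsum_cong' refl finsum_ldistr) (auto intro!: finsum_closed)
  also have "\<dots> = (\<Oplus>i\<in>A. \<Oplus>p\<in>P. f i \<otimes> \<sigma> i (g (p - i)) \<otimes> \<sigma> p (h (k - p)))"
    using cl by (intro finsum_swap[OF P A]) auto
  also have "\<dots> = (\<Oplus>i\<in>A. f i \<otimes> \<sigma> i (conv g h (k - i)))"
  proof (rule finsum_cong'[OF refl])
    fix i assume i: "i \<in> A"
    then have isf: "i \<in> supp f" by (auto simp: A_def)
    \<comment> \<open>Substituting \<open>j = p - i\<close> makes the inner sum run over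
      \<open>P\<close>; surplus indices contribute zero. Applying \<open>\<sigma> i\<close> then
      turns \<open>\<sigma> (p - i)\<close> into \<open>\<sigma> p\<close>.\<close>
    let ?B = "(\<lambda>p. p - i) ` P"
    have inj: "inj_on (\<lambda>p. p - i) P" by (auto simp: inj_on_def)
    have "conv g h (k - i) = (\<Oplus>j\<in>?B. g j \<otimes> \<sigma> j (h (k - i - j)))"
    proof (rule conv_eq[OF g h])
      fix j assume j: "j \<in> supp g" "k - i - j \<in> supp h"
      then have "i + j \<in> P" using fgP[OF isf] by (simp add: diff_diff_eq)
      then show "j \<in> ?B" by force
    qed (use P in simp)
    also have "\<dots> = (\<Oplus>p\<in>P. g (p - i) \<otimes> \<sigma> (p - i) (h (k - i - (p - i))))"
      using cl by (intro finsum_reindex inj) auto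
    also have "\<dots> = (\<Oplus>p\<in>P. g (p - i) \<otimes> \<sigma> (p - i) (h (k - p)))"
      by simp
    finally have "\<sigma> i (conv g h (k - i)) = (\<Oplus>p\<in>P. \<sigma> i (g (p - i) \<otimes> \<sigma> (p - i) (h (k - p))))"
      using cl by (simp add: twist_finsum)
    also have "\<dots> = (\<Oplus>p\<in>P. \<sigma> i (g (p - i)) \<otimes> \<sigma> p (h (k - p)))"
      using cl by (intro finsum_cong' refl) (auto simp: twist_mult twist_add[symmetric])
    finally have "f i \<otimes> \<sigma> i (conv g h (k - i)) =
        f i \<otimes> (\<Oplus>p\<in>P. \<sigma> i (g (p - i)) \<otimes> \<sigma> p (h (k - p)))" by simp
    also have "\<dots> = (\<Oplus>p\<in>P. f i \<otimes> (\<sigma> i (g (p - i)) \<otimes> \<sigma> p (h (k - p))))"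
      using P cl by (intro finsum_rdistr) auto
    also have "\<dots> = (\<Oplus>p\<in>P. f i \<otimes> \<sigma> i (g (p - i)) \<otimes> \<sigma> p (h (k - p)))"
      using cl by (intro finsum_cong' refl) (auto simp: m_assoc)
    finally show "(\<Oplus>p\<in>P. f i \<otimes> \<sigma> i (g (p - i)) \<otimes> \<sigma> p (h (k - p))) =
        f i \<otimes> \<sigma> i (conv g h (k - i))" by simp
  qed (use cl conv_coeff_closed[OF g h] in auto)
  also have "\<dots> = conv f (conv g h) k"
  proof (rule conv_eq[OF f conv_closed[OF g h] A, symmetric])
    fix i assume i: "i \<in> supp f" "k - i \<in> supp (conv g h)"
    obtain j where j: "j \<in> supp g" "k - i - j \<in> supp h" using supp_conv[OF g h i(2)] by blast
    have "i + j \<in> P" using fgP[OF i(1) j(1)] j(2) by (simp add: diff_diff_eq)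
    then show "i \<in> A" using i j by (force simp: A_def)
  qed
  finally show "conv (conv f g) h k = conv f (conv g h) k" .
qed

lemma add_closed:
  assumes "f \<in> carrier D" "g \<in> carrier D"
  shows "(\<lambda>k. f k \<oplus> g k) \<in> carrier D"
  by (rule carrier_DI[OF _ supports_Un[OF supp_in[OF assms(1)] supp_in[OF assms(2)]]])
    (use coeff_closed[OF assms(1)] coeff_closed[OF assms(2)] in \<open>auto simp: support_def\<close>)

lemma mono_closed [simp]: "a \<in> carrier R \<Longrightarrow> smono a m \<in> carrier D"
  by (rule carrier_DI[OF _ supports_singleton[of m]]) (auto simp: series_mono_def)

lemma zero_closed_D: "(\<lambda>_. \<zero>) \<in> carrier D"
  by (rule carrier_DI[OF _ supports_singleton]) auto

lemma conv_add_left: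
  assumes f: "f \<in> carrier D" and g: "g \<in> carrier D" and h: "h \<in> carrier D"
  shows "conv (\<lambda>k. f k \<oplus> g k) h = (\<lambda>k. conv f h k \<oplus> conv g h k)"
proof
  fix k
  let ?A = "{i \<in> supp f \<union> supp g. k - i \<in> supp h}"
  have A: "finite ?A" by (intro supports_finite_pairs supports_Un supp_in f g h)
  note cl = coeff_closed[OF f] coeff_closed[OF g] coeff_closed[OF h]
  have "conv (\<lambda>k. f k \<oplus> g k) h k = (\<Oplus>i\<in>?A. (f i \<oplus> g i) \<otimes> \<sigma> i (h (k - i)))"
    using cl by (intro conv_eq[OF add_closed[OF f g] h A]) (auto simp: support_def)
  also have "\<dots> = (\<Oplus>i\<in>?A. f i \<otimes> \<sigma> i (h (k - i)) \<oplus> g i \<otimes> \<sigma> i (h (k - i)))"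
    using cl by (intro finsum_cong' refl) (auto simp: l_distr)
  also have "\<dots> = (\<Oplus>i\<in>?A. f i \<otimes> \<sigma> i (h (k - i))) \<oplus> (\<Oplus>i\<in>?A. g i \<otimes> \<sigma> i (h (k - i)))"
    using cl by (intro finsum_addf) auto
  also have "(\<Oplus>i\<in>?A. f i \<otimes> \<sigma> i (h (k - i))) = conv f h k"
    by (rule conv_eq[OF f h A, symmetric]) auto
  also have "(\<Oplus>i\<in>?A. g i \<otimes> \<sigma> i (h (k - i))) = conv g h k"
    by (rule conv_eq[OF g h A, symmetric]) auto
  finally show "conv (\<lambda>k. f k \<oplus> g k) h k = conv f h k \<oplus> conv g h k" .
qed

lemma conv_add_right:
  assumes f: "f \<in> carrier D" and g: "g \<in> carrier D" and h: "h \<in> carrier D"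
  shows "conv h (\<lambda>k. f k \<oplus> g k) = (\<lambda>k. conv h f k \<oplus> conv h g k)"
proof
  fix k
  let ?A = "{i \<in> supp h. k - i \<in> supp f \<union> supp g}"
  have A: "finite ?A" by (intro supports_finite_pairs supports_Un supp_in f g h)
  note cl = coeff_closed[OF f] coeff_closed[OF g] coeff_closed[OF h]
  have "conv h (\<lambda>k. f k \<oplus> g k) k = (\<Oplus>i\<in>?A. h i \<otimes> \<sigma> i (f (k - i) \<oplus> g (k - i)))"
    using cl by (intro conv_eq[OF h add_closed[OF f g] A]) (auto simp: support_def)
  also have "\<dots> = (\<Oplus>i\<in>?A. h i \<otimes> \<sigma> i (f (k - i)) \<oplus> h i \<otimes> \<sigma> i (g (k - i)))"
    using cl by (intro finsum_cong' refl) (auto simp: r_distr twist_plus)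
  also have "\<dots> = (\<Oplus>i\<in>?A. h i \<otimes> \<sigma> i (f (k - i))) \<oplus> (\<Oplus>i\<in>?A. h i \<otimes> \<sigma> i (g (k - i)))"
    using cl by (intro finsum_addf) auto
  also have "(\<Oplus>i\<in>?A. h i \<otimes> \<sigma> i (f (k - i))) = conv h f k"
    by (rule conv_eq[OF h f A, symmetric]) auto
  also have "(\<Oplus>i\<in>?A. h i \<otimes> \<sigma> i (g (k - i))) = conv h g k"
    by (rule conv_eq[OF h g A, symmetric]) auto
  finally show "conv h (\<lambda>k. f k \<oplus> g k) k = conv h f k \<oplus> conv h g k" .
qed

lemma mono_conv:
  assumes "a \<in> carrier R" "f \<in> carrier D"
  shows "conv (smono a m) f = (\<lambda>k. a \<otimes> \<sigma> m (f (k - m)))"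
proof
  fix k
  have "conv (smono a m) f k = (\<Oplus>i\<in>{m}. smono a m i \<otimes> \<sigma> i (f (k - i)))"
    by (rule conv_eq[OF mono_closed[OF assms(1)] assms(2)])
      (auto simp: support_def series_mono_def split: if_splits)
  then show "conv (smono a m) f k = a \<otimes> \<sigma> m (f (k - m))"
    using assms(1) coeff_closed[OF assms(2)] by (simp add: series_mono_def)
qed

lemma conv_mono:
  assumes "a \<in> carrier R" "f \<in> carrier D"
  shows "conv f (smono a m) = (\<lambda>k. f (k - m) \<otimes> \<sigma> (k - m) a)"
proof
  fix k
  have "conv f (smono a m) k = (\<Oplus>i\<in>{k - m}. f i \<otimes> \<sigma> i (smono a m (k - i)))"
    by (rule conv_eq[OF assms(2) mono_closed[OF assms(1)]])
      (auto simp: support_def series_mono_def split: if_splits)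
  then show "conv f (smono a m) k = f (k - m) \<otimes> \<sigma> (k - m) a"
    using assms(1) coeff_closed[OF assms(2)] by (simp add: series_mono_def)
qed

lemma mono_conv_mono:
  assumes "a \<in> carrier R" "b \<in> carrier R"
  shows "conv (smono a m) (smono b n) = smono (a \<otimes> \<sigma> m b) (m + n)"
  unfolding mono_conv[OF assms(1) mono_closed[OF assms(2)]]
  using assms by (auto simp: series_mono_def fun_eq_iff algebra_simps)

sublocale D: ring D
proof (rule ringI)
  show "abelian_group D"
  proof (rule abelian_groupI)
    fix f assume f: "f \<in> carrier D"
    have "(\<lambda>k. \<ominus> f k) \<in> carrier D"
      by (rule carrier_DI[OF _ supp_in[OF f]]) (use coeff_closed[OF f] not_supp in auto)
    then show "\<exists>g\<in>carrier D. g \<oplus>\<^bsub>D\<^esub> f = \<zero>\<^bsub>D\<^esub>"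
      using coeff_closed[OF f]
      by (intro bexI[of _ "\<lambda>k. \<ominus> f k"]) (auto simp: add_D zero_D l_neg)
  qed (auto simp: add_D zero_D add_closed zero_closed_D a_assoc coeff_closed intro!: ext intro: a_comm)
  show "monoid D"
  proof (rule monoidI)
    fix f assume f: "f \<in> carrier D"
    show "\<one>\<^bsub>D\<^esub> \<otimes>\<^bsub>D\<^esub> f = f" "f \<otimes>\<^bsub>D\<^esub> \<one>\<^bsub>D\<^esub> = f"
      using f coeff_closed[OF f] by (simp_all add: mult_D one_D mono_conv conv_mono twist_0)
  qed (auto simp: mult_D one_D conv_closed conv_assoc)
qed (auto simp: mult_D add_D conv_add_left conv_add_right)

section \<open>Subtraction and inverses\<close>

lemma minus_D:
  assumes "f \<in> carrier D" "g \<in> carrier D"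
  shows "f \<ominus>\<^bsub>D\<^esub> g = (\<lambda>k. f k \<ominus> g k)"
proof -
  have "(\<lambda>k. \<ominus> g k) \<in> carrier D"
    by (rule carrier_DI[OF _ supp_in[OF assms(2)]]) (use coeff_closed[OF assms(2)] not_supp in auto)
  moreover have "g \<oplus>\<^bsub>D\<^esub> (\<lambda>k. \<ominus> g k) = \<zero>\<^bsub>D\<^esub>"
    using coeff_closed[OF assms(2)] by (auto simp: add_D zero_D r_neg)
  ultimately have "\<ominus>\<^bsub>D\<^esub> g = (\<lambda>k. \<ominus> g k)"
    using assms by (metis D.minus_equality D.minus_minus)
  then show ?thesis by (simp add: a_minus_def add_D)
qed

text \<open>Since \<open>p 0 = \<one>\<close> and \<open>\<sigma> 0\<close> is the identity, the
  equation at degree \<open>k\<close> expresses \<open>g k\<close> through coefficients at smaller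
  degrees \<open>k - i\<close>. It is solved by recursion on a set \<open>M\<close> that contains 0
  and absorbs the remaining support of \<open>p\<close>.\<close>

lemma conv_right_inverse:
  assumes p: "p \<in> carrier D" and p0: "p 0 = \<one>" and pos: "\<And>k. k \<in> supp p \<Longrightarrow> 0 \<le> k"
  shows "\<exists>g\<in>carrier D. conv p g = smono \<one> 0"
proof -
  define U where "U = supp p - {0}"
  have "U \<in> \<W>" using supports_subset[OF supp_in[OF p]] by (auto simp: U_def)
  moreover have Upos: "0 < s" if "s \<in> U" for s
    using that pos[of s] by (auto simp: U_def)
  ultimately obtain M where M: "M \<in> \<W>" "0 \<in> M" "\<And>s m. s \<in> U \<Longrightarrow> m \<in> M \<Longrightarrow> s + m \<in> M"
    using supports_absorb by blast
  \<comment> \<open>The order of the index group need not be well-founded, but its restriction to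
    \<open>M\<close> is: the finite number of elements of \<open>M\<close> up to \<open>b\<close>
    strictly increases with \<open>b\<close> in \<open>M\<close>.\<close>
  define r where "r = {(a, b). a \<in> M \<and> b \<in> M \<and> a < b}"
  have "{x \<in> M. x \<le> a} \<subset> {x \<in> M. x \<le> b}" if "(a, b) \<in> r" for a b
  proof -
    have "a < b" "b \<in> M" using that by (auto simp: r_def)
    then have "b \<in> {x \<in> M. x \<le> b} - {x \<in> M. x \<le> a}" "{x \<in> M. x \<le> a} \<subseteq> {x \<in> M. x \<le> b}"
      by auto
    then show ?thesis by blast
  qed
  then have "r \<subseteq> measure (\<lambda>b. card {x \<in> M. x \<le> b})"
    using psubset_card_mono[OF supports_locally_finite[OF M(1)]] by auto
  then have wf: "wf r" using wf_subset by blast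
  define A where "A k = {i \<in> U. k - i \<in> M}" for k
  have A: "finite (A k)" for k
    unfolding A_def by (intro supports_finite_pairs M \<open>U \<in> \<W>\<close>)
  \<comment> \<open>The value zero outside \<open>M\<close> keeps the support admissible. Inside
    \<open>M\<close>, every recursive call is at some \<open>k - i\<close> in \<open>M\<close> below
    \<open>k\<close>, so \<open>cut\<close> does not change it.\<close>
  define H where "H g k = (if k \<in> M then smono \<one> 0 k \<ominus> (\<Oplus>i\<in>A k. p i \<otimes> \<sigma> i (g (k - i))) else \<zero>)"
    for g k
  define g where "g = wfrec r H"
  have g_cut: "g k = H (cut g r k) k" for k
    unfolding g_def using wfrec[OF wf] .
  have cut: "cut g r k (k - i) = g (k - i)" and rel: "(k - i, k) \<in> r" if "k \<in> M" "i \<in> A k" for k i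
    using that Upos by (auto simp: A_def r_def cut_def)
  note pc = coeff_closed[OF p]
  have gc: "g k \<in> carrier R" for k
    using wf
  proof (induction k rule: wf_induct_rule)
    case (less k)
    have "k \<in> M \<Longrightarrow> (\<lambda>i. p i \<otimes> \<sigma> i (cut g r k (k - i))) \<in> A k \<rightarrow> carrier R"
      using less rel cut pc by auto
    then show ?case
      unfolding g_cut[of k] H_def by (auto simp: series_mono_def intro!: minus_closed finsum_closed)
  qed
  have gM: "g k = smono \<one> 0 k \<ominus> (\<Oplus>i\<in>A k. p i \<otimes> \<sigma> i (g (k - i)))" if "k \<in> M" for k
  proof -
    have "(\<Oplus>i\<in>A k. p i \<otimes> \<sigma> i (cut g r k (k - i))) = (\<Oplus>i\<in>A k. p i \<otimes> \<sigma> i (g (k - i)))"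
      using gc pc cut[OF that] by (intro finsum_cong' refl) auto
    then show ?thesis using that unfolding g_cut[of k] H_def by simp
  qed
  have gn: "g k = \<zero>" if "k \<notin> M" for k
    using that unfolding g_cut[of k] H_def by simp
  have g: "g \<in> carrier D"
    by (rule carrier_DI[OF gc M(1) gn])
  have "conv p g k = smono \<one> 0 k" for k
  proof -
    have "conv p g k = (\<Oplus>i\<in>insert 0 (A k). p i \<otimes> \<sigma> i (g (k - i)))"
    proof (rule conv_eq[OF p g])
      fix i assume i: "i \<in> supp p" "k - i \<in> supp g"
      then have "k - i \<in> M" using gn by (auto simp: support_def)
      then show "i \<in> insert 0 (A k)" using i by (auto simp: A_def U_def)
    qed (use A in simp)
    also have "\<dots> = p 0 \<otimes> \<sigma> 0 (g (k - 0)) \<oplus> (\<Oplus>i\<in>A k. p i \<otimes> \<sigma> i (g (k - i)))"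
      using A gc pc by (intro finsum_insert) (auto simp: A_def U_def)
    also have "\<dots> = g k \<oplus> (\<Oplus>i\<in>A k. p i \<otimes> \<sigma> i (g (k - i)))"
      using gc p0 by (simp add: twist_0)
    also have "\<dots> = smono \<one> 0 k"
    proof (cases "k \<in> M")
      case True
      have "(\<Oplus>i\<in>A k. p i \<otimes> \<sigma> i (g (k - i))) \<in> carrier R" "smono \<one> 0 k \<in> carrier R"
        using pc gc by (auto intro!: finsum_closed simp: series_mono_def)
      then show ?thesis unfolding gM[OF True] by (simp add: a_minus_def a_assoc l_neg)
    next
      case False
      \<comment> \<open>For \<open>i\<close> in \<open>A k\<close>, absorption would put
        \<open>k = i + (k - i)\<close> into \<open>M\<close>.\<close>
      have "A k = {}" using M(3)[of _ "k - _"] False by (force simp: A_def)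
      moreover have "k \<noteq> 0" using False M(2) by blast
      ultimately show ?thesis using gn[OF False] by (simp add: series_mono_def)
    qed
    finally show ?thesis .
  qed
  then show ?thesis using g by blast
qed

text \<open>Multiplying \<open>f\<close> on the right by a monomial of degree \<open>- m\<close>,
  where \<open>m\<close> is the order of \<open>f\<close>, moves the lowest term to degree 0 and
  normalizes it to one. \<open>conv_right_inverse\<close> applies to the product \<open>p\<close>,
  and the monomial times that inverse is a right inverse of \<open>f\<close>.\<close>

lemma series_division_ring:
  assumes "division_ring R"
  shows "division_ring D"
proof (rule D.division_ringI)
  interpret R: division_ring R by fact
  show "\<one>\<^bsub>D\<^esub> \<noteq> \<zero>\<^bsub>D\<^esub>"
    using R.one_not_zero by (auto simp: one_D zero_D series_mono_def fun_eq_iff)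
  fix f assume f: "f \<in> carrier D" "f \<noteq> \<zero>\<^bsub>D\<^esub>"
  have "supp f \<noteq> {}" using f(2) by (auto simp: zero_D support_def)
  then obtain m where m: "m \<in> supp f" "\<And>k. k \<in> supp f \<Longrightarrow> m \<le> k"
    using supports_Min supp_in[OF f(1)] by metis
  have "f m \<in> Units R" using m coeff_closed[OF f(1)] by (auto simp: R.division_ring_Units support_def)
  then have inv: "inv (f m) \<in> carrier R" "f m \<otimes> inv (f m) = \<one>" by auto
  \<comment> \<open>The twist by \<open>- m\<close> is undone when the coefficient passes t^m, so
    that \<open>p 0\<close> becomes \<open>f m \<otimes> inv (f m)\<close>.\<close>
  define b where "b = \<sigma> (- m) (inv (f m))"
  have b: "b \<in> carrier R" "f m \<otimes> \<sigma> m b = \<one>"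
    using inv by (simp_all add: b_def twist_add[symmetric] twist_0)
  define p where "p = conv f (smono b (- m))"
  have p: "p \<in> carrier D"
    unfolding p_def by (intro conv_closed f mono_closed b)
  have pk: "p k = f (k + m) \<otimes> \<sigma> (k + m) b" for k
    unfolding p_def conv_mono[OF b(1) f(1)] by simp
  have "0 \<le> k" if "k \<in> supp p" for k
  proof -
    have "k + m \<in> supp f" using that b by (auto simp: pk support_def)
    then show ?thesis using m(2) by force
  qed
  then obtain g where g: "g \<in> carrier D" "conv p g = smono \<one> 0"
    using conv_right_inverse[OF p] pk b by auto
  show "\<exists>y\<in>carrier D. f \<otimes>\<^bsub>D\<^esub> y = \<one>\<^bsub>D\<^esub>"
    using f b g by (intro bexI[of _ "conv (smono b (- m)) g"])
      (auto simp: mult_D one_D conv_closed conv_assoc[symmetric] p_def[symmetric])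
qed

end

section \<open>Laurent series over Puiseux series, twisted by squaring the variable\<close>

definition puiseux_supports :: "rat set set"
  where "puiseux_supports = {A. \<exists>n>0. \<exists>b. \<forall>s\<in>A. b \<le> s \<and> of_nat n * s \<in> \<int>}"

definition laurent_supports :: "int set set"
  where "laurent_supports = {A. \<exists>b. \<forall>s\<in>A. b \<le> s}"

text \<open>
  With \<open>\<lambda>_ a. a\<close> instead, instances such as \<open>a \<in> carrier R \<Longrightarrow> a \<in> carrier R\<close> of the twist rules
  would make the simplifier loop.
\<close>

definition trivial_twist :: "rat \<Rightarrow> 'a \<Rightarrow> 'a"
  where "trivial_twist i a = a"

text \<open>The \<open>i\<close>-th iterate of the substitution x -> x^2: the coefficient of x^q in
  the image is that of x^(q / 2^i) in \<open>f\<close>. Rational exponents make it available for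
  negative \<open>i\<close> too.\<close>

definition dilate :: "int \<Rightarrow> (rat \<Rightarrow> 'a) \<Rightarrow> rat \<Rightarrow> 'a"
  where "dilate i f = (\<lambda>q. f (q * 2 powi (- i)))"

section \<open>Supports with a common denominator\<close>

lemma puiseux_supportsI:
  assumes "0 < n" "\<And>s. s \<in> A \<Longrightarrow> b \<le> s" "\<And>s. s \<in> A \<Longrightarrow> of_nat n * s \<in> \<int>"
  shows "A \<in> puiseux_supports"
  using assms unfolding puiseux_supports_def by blast

lemma puiseux_supportsE:
  assumes "A \<in> puiseux_supports"
  obtains n b where "0 < n" "\<And>s. s \<in> A \<Longrightarrow> b \<le> s" "\<And>s. s \<in> A \<Longrightarrow> of_nat n * s \<in> \<int>"
  using assms unfolding puiseux_supports_def by blast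

text \<open>Writing c = p / q, the identity n p s = q n (s c) shows that n p is a common denominator
  after rescaling. This is why dilations preserve admissible supports.\<close>

lemma puiseux_supports_scale:
  assumes "A \<in> puiseux_supports" "0 < c"
  shows "{s. s * c \<in> A} \<in> puiseux_supports"
proof -
  obtain n b where A: "0 < n" "\<And>s. s \<in> A \<Longrightarrow> b \<le> s" "\<And>s. s \<in> A \<Longrightarrow> of_nat n * s \<in> \<int>"
    using puiseux_supportsE[OF assms(1)] by blast
  obtain p q where pq: "quotient_of c = (p, q)" by (cases "quotient_of c")
  have q: "0 < q" "c = of_int p / of_int q"
    using quotient_of_denom_pos[OF pq] quotient_of_div[OF pq] by auto
  have p: "0 < p" using assms(2) q by (simp add: zero_less_divide_iff)
  show ?thesis
  proof (rule puiseux_supportsI)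
    show "0 < n * nat p" using A(1) p by simp
    fix s assume s: "s \<in> {s. s * c \<in> A}"
    show "b / c \<le> s" using A(2) s assms(2) by (simp add: field_simps)
    have "of_int q * (of_nat n * (s * c)) \<in> \<int>" using A(3) s by (intro Ints_mult[OF Ints_of_int]) auto
    moreover have "of_int q * (of_nat n * (s * c)) = of_nat (n * nat p) * s"
      using p q by (simp add: field_simps)
    ultimately show "of_nat (n * nat p) * s \<in> \<int>" by simp
  qed
qed

lemma twisted_series_puiseux:
  assumes "ring R"
  shows "twisted_series R trivial_twist puiseux_supports"
proof (intro twisted_series.intro twisted_series_axioms.intro assms)
  show "trivial_twist i \<in> ring_hom R R" for i
    by (rule ring_hom_memI) (auto simp: trivial_twist_def)
next
  fix A B assume "A \<in> puiseux_supports" "B \<subseteq> A"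
  then show "B \<in> puiseux_supports" unfolding puiseux_supports_def by blast
next
  fix A B assume "A \<in> puiseux_supports" "B \<in> puiseux_supports"
  then obtain n b m c where
    A: "0 < n" "\<And>s. s \<in> A \<Longrightarrow> b \<le> s" "\<And>s. s \<in> A \<Longrightarrow> of_nat n * s \<in> \<int>" and
    B: "0 < m" "\<And>s. s \<in> B \<Longrightarrow> c \<le> s" "\<And>s. s \<in> B \<Longrightarrow> of_nat m * s \<in> \<int>"
    by (elim puiseux_supportsE) blast
  \<comment> \<open>The product \<open>n * m\<close> serves as a common denominator for both
    sets.\<close>
  have nmA: "of_nat (n * m) * s \<in> \<int>" if "s \<in> A" for s
    using Ints_mult[OF Ints_of_nat[of m] A(3)[OF that]] by (simp add: mult_ac)
  have nmB: "of_nat (n * m) * s \<in> \<int>" if "s \<in> B" for s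
    using Ints_mult[OF Ints_of_nat[of n] B(3)[OF that]] by (simp add: mult_ac)
  show "A \<union> B \<in> puiseux_supports"
  proof (rule puiseux_supportsI[of "n * m" _ "min b c"])
    fix s assume "s \<in> A \<union> B"
    then show "min b c \<le> s" "of_nat (n * m) * s \<in> \<int>"
      using A(2) B(2) nmA nmB by (auto simp: min_le_iff_disj simp del: of_nat_mult)
  qed (use A B in simp)
  show "{s + t |s t. s \<in> A \<and> t \<in> B} \<in> puiseux_supports"
  proof (rule puiseux_supportsI[of "n * m" _ "b + c"])
    fix s assume "s \<in> {s + t |s t. s \<in> A \<and> t \<in> B}"
    then obtain u v where "s = u + v" "u \<in> A" "v \<in> B" by blast
    then show "b + c \<le> s" "of_nat (n * m) * s \<in> \<int>"
      using A(2) B(2) Ints_add[OF nmA nmB]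
      by (auto simp: add_mono distrib_left simp del: of_nat_mult)
  qed (use A B in simp)
next
  fix i
  obtain p q where pq: "quotient_of i = (p, q)" by (cases "quotient_of i")
  have q: "0 < q" "i = of_int p / of_int q"
    using quotient_of_denom_pos[OF pq] quotient_of_div[OF pq] by auto
  show "{i} \<in> puiseux_supports"
    by (rule puiseux_supportsI[of "nat q" _ i]) (use q in auto)
next
  fix A k assume "A \<in> puiseux_supports"
  then obtain n b where
    A: "0 < n" "\<And>s. s \<in> A \<Longrightarrow> b \<le> s" "\<And>s. s \<in> A \<Longrightarrow> of_nat n * s \<in> \<int>"
    using puiseux_supportsE by blast
  \<comment> \<open>Each element is an integer over \<open>n\<close>, and the bounds
    \<open>b\<close> and \<open>k\<close> leave finitely many numerators.\<close>
  have "{s \<in> A. s \<le> k} \<subseteq> (\<lambda>i. of_int i / of_nat n) ` {\<lfloor>of_nat n * b\<rfloor>..\<lfloor>of_nat n * k\<rfloor>}"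
  proof
    fix s assume s: "s \<in> {s \<in> A. s \<le> k}"
    then obtain i where i: "of_nat n * s = of_int i" using A(3) Ints_cases by blast
    have "of_nat n * b \<le> of_int i" "of_int i \<le> of_nat n * k"
      using A(1,2) s by (auto simp: i[symmetric] intro!: mult_left_mono)
    then have "\<lfloor>of_nat n * b\<rfloor> \<le> i" "i \<le> \<lfloor>of_nat n * k\<rfloor>"
      by (auto simp: le_floor_iff floor_le_iff)
    moreover have "s = of_int i / of_nat n" using A(1) by (simp add: i[symmetric])
    ultimately show "s \<in> (\<lambda>i. of_int i / of_nat n) ` {\<lfloor>of_nat n * b\<rfloor>..\<lfloor>of_nat n * k\<rfloor>}" by auto
  qed
  then show "finite {s \<in> A. s \<le> k}" using finite_subset by blast
next
  fix A :: "rat set" assume "A \<in> puiseux_supports" and pos: "\<And>s. s \<in> A \<Longrightarrow> 0 < s"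
  obtain n where A: "0 < n" "\<And>s. s \<in> A \<Longrightarrow> of_nat n * s \<in> \<int>"
    using puiseux_supportsE[OF \<open>A \<in> puiseux_supports\<close>] by metis
  \<comment> \<open>The nonnegative multiples of 1/n form an admissible set that is stable under
    adding elements of \<open>A\<close>, because \<open>n\<close> is a denominator for all of
    \<open>A\<close>.\<close>
  let ?M = "{m. 0 \<le> m \<and> of_nat n * m \<in> \<int>}"
  have "?M \<in> puiseux_supports"
    by (rule puiseux_supportsI[OF A(1)]) auto
  moreover have "s + m \<in> ?M" if "s \<in> A" "m \<in> ?M" for s m
    using that pos[of s] A(2)[of s] by (auto simp: distrib_left)
  ultimately show "\<exists>M\<in>puiseux_supports. 0 \<in> M \<and> (\<forall>s\<in>A. \<forall>m\<in>M. s + m \<in> M)"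
    by (intro bexI[of _ ?M]) auto
qed (auto simp: trivial_twist_def)

text \<open>In terms of exponents: the substitution x -> x^(2^k) moves x.\<close>

lemma two_powi_neq_one:
  assumes "k \<noteq> 0"
  shows "2 powi k \<noteq> (1 :: rat)"
proof (cases "0 < k")
  case True
  then show ?thesis using power_int_strict_increasing[of 0 k "2 :: rat"] by simp
next
  case False
  then show ?thesis using assms power_int_strict_increasing[of k 0 "2 :: rat"] by simp
qed

context field
begin

section \<open>The series ring in x, its dilations, and the Laurent series in t\<close>

sublocale K: twisted_series R trivial_twist puiseux_supports
  by (rule twisted_series_puiseux) (rule ring_axioms)

lemma dilate_closed:
  assumes "f \<in> carrier K.D"
  shows "dilate i f \<in> carrier K.D"
proof (rule K.carrier_DI)
  show "{s. s * 2 powi (- i) \<in> K.supp f} \<in> puiseux_supports"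
    by (intro puiseux_supports_scale K.supp_in assms) simp
  show "dilate i f q \<in> carrier R" for q
    unfolding dilate_def by (rule K.coeff_closed[OF assms])
  show "dilate i f q = \<zero>" if "q \<notin> {s. s * 2 powi (- i) \<in> K.supp f}" for q
    using that unfolding dilate_def by (intro K.not_supp) simp
qed

text \<open>Multiplication by the nonzero number \<open>c\<close> is an additive bijection of the
  exponents, so it reindexes the convolution sum.\<close>

lemma dilate_conv:
  assumes f: "f \<in> carrier K.D" and g: "g \<in> carrier K.D"
  shows "dilate i (K.conv f g) = K.conv (dilate i f) (dilate i g)"
proof
  fix q :: rat
  define c :: rat where "c = 2 powi (- i)"
  have c: "c \<noteq> 0" by (simp add: c_def)
  define A where "A = {j. j * c \<in> K.supp f \<and> (q - j) * c \<in> K.supp g}"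
  have inj: "inj_on (\<lambda>j. j * c) A" using c by (auto simp: inj_on_def)
  have img: "{j \<in> K.supp f. q * c - j \<in> K.supp g} = (\<lambda>j. j * c) ` A"
  proof (intro equalityI subsetI)
    fix j assume "j \<in> {j \<in> K.supp f. q * c - j \<in> K.supp g}"
    then have "j / c \<in> A" using c by (auto simp: A_def left_diff_distrib)
    then show "j \<in> (\<lambda>j. j * c) ` A" using c by (intro image_eqI[of _ _ "j / c"]) auto
  qed (auto simp: A_def left_diff_distrib)
  have "dilate i (K.conv f g) q = (\<Oplus>j\<in>(\<lambda>j. j * c) ` A. f j \<otimes> g (q * c - j))"
    unfolding dilate_def twisted_conv_def trivial_twist_def c_def[symmetric] img ..
  also have "\<dots> = (\<Oplus>j\<in>A. f (j * c) \<otimes> g (q * c - j * c))"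
    using K.coeff_closed[OF f] K.coeff_closed[OF g] by (intro finsum_reindex inj) auto
  also have "\<dots> = K.conv (dilate i f) (dilate i g) q"
    unfolding dilate_def twisted_conv_def trivial_twist_def c_def[symmetric] A_def support_def
      left_diff_distrib mem_Collect_eq ..
  finally show "dilate i (K.conv f g) q = K.conv (dilate i f) (dilate i g) q" .
qed

lemma dilate_mono: "dilate i (K.smono a q) = K.smono a (q * 2 powi i)"
  by (auto simp: dilate_def series_mono_def fun_eq_iff power_int_minus field_simps)

lemma dilate_hom: "dilate i \<in> ring_hom K.D K.D"
proof (rule ring_hom_memI)
  show "dilate i \<one>\<^bsub>K.D\<^esub> = \<one>\<^bsub>K.D\<^esub>"
    by (simp add: K.one_D dilate_mono)
qed (auto simp: dilate_closed K.mult_D K.add_D dilate_conv, auto simp: dilate_def)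

text \<open>The exponents of t are integers, so a lower bound alone gives local finiteness, and the
  nonnegative integers absorb every set of positive ones.\<close>

lemma twisted_series_dilate: "twisted_series K.D dilate laurent_supports"
proof (intro twisted_series.intro twisted_series_axioms.intro K.D.ring_axioms dilate_hom)
  fix f :: "rat \<Rightarrow> 'a" and i j
  show "dilate 0 f = f" by (simp add: dilate_def)
  have "2 powi (- (i + j)) = 2 powi (- i) * (2 powi (- j) :: rat)"
    by (simp flip: power_int_add)
  then show "dilate (i + j) f = dilate i (dilate j f)"
    by (simp add: dilate_def mult_ac)
next
  fix A B assume "A \<in> laurent_supports" "B \<subseteq> A"
  then show "B \<in> laurent_supports" unfolding laurent_supports_def by blast
next
  fix A B assume "A \<in> laurent_supports" "B \<in> laurent_supports"
  then obtain b c where bc: "\<And>s. s \<in> A \<Longrightarrow> b \<le> s" "\<And>s. s \<in> B \<Longrightarrow> c \<le> s"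
    unfolding laurent_supports_def by blast
  have "\<forall>s\<in>A \<union> B. min b c \<le> s" using bc by (auto simp: min_le_iff_disj)
  then show "A \<union> B \<in> laurent_supports" unfolding laurent_supports_def by blast
  have "\<forall>s\<in>{s + t |s t. s \<in> A \<and> t \<in> B}. b + c \<le> s" using bc by (auto intro: add_mono)
  then show "{s + t |s t. s \<in> A \<and> t \<in> B} \<in> laurent_supports"
    unfolding laurent_supports_def by blast
next
  fix i show "{i} \<in> laurent_supports" unfolding laurent_supports_def by blast
next
  fix A k assume "A \<in> laurent_supports"
  then obtain b where "\<And>s. s \<in> A \<Longrightarrow> b \<le> s" unfolding laurent_supports_def by blast
  then have "{s \<in> A. s \<le> k} \<subseteq> {b..k}" by auto
  then show "finite {s \<in> A. s \<le> k}" using finite_subset by blast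
next
  fix A :: "int set" assume "\<And>s. s \<in> A \<Longrightarrow> 0 < s"
  then show "\<exists>M\<in>laurent_supports. 0 \<in> M \<and> (\<forall>s\<in>A. \<forall>m\<in>M. s + m \<in> M)"
    by (intro bexI[of _ "{0..}"]) (auto simp: laurent_supports_def less_imp_le)
qed

sublocale L: twisted_series K.D dilate laurent_supports
  by (rule twisted_series_dilate)

lemma K_division_ring: "division_ring K.D"
proof (rule K.series_division_ring)
  show "division_ring R" using field_Units one_not_zero by unfold_locales auto
qed

lemma L_division_ring: "division_ring L.D"
  by (rule L.series_division_ring[OF K_division_ring])

text \<open>The least nonzero exponent \<open>m\<close> contradicts closure of the support under
  halving if \<open>m\<close> is positive, and under doubling if it is negative.\<close>

lemma dilate_fixed:
  assumes h: "h \<in> carrier K.D" and fixed: "dilate 1 h = h"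
  shows "h = K.smono (h 0) 0"
proof (rule ccontr)
  assume "h \<noteq> K.smono (h 0) 0"
  then obtain q where "h q \<noteq> K.smono (h 0) 0 q" by blast
  then have "q \<in> K.supp h - {0}" by (auto simp: series_mono_def support_def split: if_splits)
  then have "K.supp h - {0} \<noteq> {}" by blast
  moreover have "K.supp h - {0} \<in> puiseux_supports"
    using K.supports_subset[OF K.supp_in[OF h]] by blast
  ultimately obtain m where m: "m \<in> K.supp h - {0}" "\<And>s. s \<in> K.supp h - {0} \<Longrightarrow> m \<le> s"
    using K.supports_Min by blast
  have half: "h (q / 2) = h q" for q
    using fun_cong[OF fixed, of q] by (simp add: dilate_def power_int_minus field_simps)
  have "m / 2 \<in> K.supp h - {0}" "2 * m \<in> K.supp h - {0}"
    using m(1) half[of m] half[of "2 * m"] by (auto simp: support_def)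
  then have "m \<le> m / 2" "m \<le> 2 * m" by (simp_all only: m(2))
  then show False using m(1) by auto
qed

text \<open>The support is invariant under translation by \<open>d\<close> and by
  \<open>- d\<close>, one of which leads below its least element.\<close>

lemma shift_invariant_zero:
  assumes h: "h \<in> carrier K.D" and d: "d \<noteq> 0" and shift: "\<And>q. h (q + d) = h q"
  shows "h = \<zero>\<^bsub>K.D\<^esub>"
proof (rule ccontr)
  assume "h \<noteq> \<zero>\<^bsub>K.D\<^esub>"
  then have "K.supp h \<noteq> {}" by (auto simp: K.zero_D support_def)
  then obtain m where m: "m \<in> K.supp h" "\<And>s. s \<in> K.supp h \<Longrightarrow> m \<le> s"
    using K.supports_Min K.supp_in[OF h] by metis
  have "m + d \<in> K.supp h" "m - d \<in> K.supp h"
    using m(1) shift[of m] shift[of "m - d"] by (auto simp: support_def)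
  then have "m \<le> m + d" "m \<le> m - d" by (simp_all only: m(2))
  then show False using d by simp
qed

section \<open>The elements x, t^n and the constants\<close>

definition gen_x :: "int \<Rightarrow> rat \<Rightarrow> 'a"
  where "gen_x = L.smono (K.smono \<one> 1) 0"

definition gen_t :: "int \<Rightarrow> int \<Rightarrow> rat \<Rightarrow> 'a"
  where "gen_t n = L.smono \<one>\<^bsub>K.D\<^esub> n"

definition const_emb :: "'a \<Rightarrow> int \<Rightarrow> rat \<Rightarrow> 'a"
  where "const_emb a = L.smono (K.smono a 0) 0"

lemma gen_x_closed: "gen_x \<in> carrier L.D"
  and gen_t_closed: "gen_t n \<in> carrier L.D"
  and const_emb_closed: "a \<in> carrier R \<Longrightarrow> const_emb a \<in> carrier L.D"
  by (simp_all add: gen_x_def gen_t_def const_emb_def)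

lemma K_mono_conv:
  assumes "h \<in> carrier K.D" "a \<in> carrier R"
  shows "K.smono a r \<otimes>\<^bsub>K.D\<^esub> h = (\<lambda>q. a \<otimes> h (q - r))"
  using assms by (simp add: K.mult_D K.mono_conv trivial_twist_def)

text \<open>Commutativity of the coefficient field gives the same right-hand side as in
  \<open>K_mono_conv\<close>; together the two rules make monomials commute with every element of
  \<open>K.D\<close>.\<close>

lemma K_conv_mono:
  assumes "h \<in> carrier K.D" "a \<in> carrier R"
  shows "h \<otimes>\<^bsub>K.D\<^esub> K.smono a r = (\<lambda>q. a \<otimes> h (q - r))"
  using assms K.coeff_closed[OF assms(1)] by (simp add: K.mult_D K.conv_mono trivial_twist_def m_comm)

lemma gen_x_mult:
  assumes "f \<in> carrier L.D"
  shows "gen_x \<otimes>\<^bsub>L.D\<^esub> f = (\<lambda>k. K.smono \<one> 1 \<otimes>\<^bsub>K.D\<^esub> f k)"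
  using assms L.coeff_closed[OF assms] by (simp add: gen_x_def L.mult_D L.mono_conv L.twist_0)

text \<open>Moving x to the left across t^k turns it into x^(2^k). The contrast with
  \<open>gen_x_mult\<close> drives both the computation of the center and that of
  commutators.\<close>

lemma mult_gen_x:
  assumes "f \<in> carrier L.D"
  shows "f \<otimes>\<^bsub>L.D\<^esub> gen_x = (\<lambda>k. f k \<otimes>\<^bsub>K.D\<^esub> K.smono \<one> (2 powi k))"
  using assms by (simp add: gen_x_def L.mult_D L.conv_mono dilate_mono)

lemma gen_t_mult:
  assumes "f \<in> carrier L.D"
  shows "gen_t n \<otimes>\<^bsub>L.D\<^esub> f = (\<lambda>k. dilate n (f (k - n)))"
  using assms L.coeff_closed[OF assms] by (simp add: gen_t_def L.mult_D L.mono_conv)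

lemma mult_gen_t:
  assumes "f \<in> carrier L.D"
  shows "f \<otimes>\<^bsub>L.D\<^esub> gen_t n = (\<lambda>k. f (k - n))"
  using assms L.coeff_closed[OF assms] by (simp add: gen_t_def L.mult_D L.conv_mono)

lemma gen_t_mult_gen_t: "gen_t m \<otimes>\<^bsub>L.D\<^esub> gen_t n = gen_t (m + n)"
  by (simp add: gen_t_def L.mult_D L.mono_conv_mono)

lemma gen_t_0: "gen_t 0 = \<one>\<^bsub>L.D\<^esub>"
  by (simp add: gen_t_def L.one_D)

section \<open>The center of the twisted Laurent series ring\<close>

lemma const_emb_central:
  assumes a: "a \<in> carrier R"
  shows "const_emb a \<in> ring_center L.D"
  unfolding ring_center_def
proof (intro CollectI conjI ballI const_emb_closed a)
  fix f assume f: "f \<in> carrier L.D"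
  have "const_emb a \<otimes>\<^bsub>L.D\<^esub> f = (\<lambda>k. K.smono a 0 \<otimes>\<^bsub>K.D\<^esub> f k)"
    using f a L.coeff_closed[OF f] by (simp add: const_emb_def L.mult_D L.mono_conv L.twist_0)
  moreover have "f \<otimes>\<^bsub>L.D\<^esub> const_emb a = (\<lambda>k. f k \<otimes>\<^bsub>K.D\<^esub> K.smono a 0)"
    using f a by (simp add: const_emb_def L.mult_D L.conv_mono dilate_mono)
  ultimately show "const_emb a \<otimes>\<^bsub>L.D\<^esub> f = f \<otimes>\<^bsub>L.D\<^esub> const_emb a"
    using a L.coeff_closed[OF f] by (simp add: K_mono_conv K_conv_mono)
qed

text \<open>Commuting with x means that x and x^(2^k) have the same product with \<open>f k\<close>,
  so \<open>f k\<close> is invariant under shifting exponents by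
  \<open>1 - 2 powi k\<close>.\<close>

lemma center_coeff_zero:
  assumes f: "f \<in> ring_center L.D" and k: "k \<noteq> 0"
  shows "f k = \<zero>\<^bsub>K.D\<^esub>"
proof -
  have fc: "f \<in> carrier L.D" using f by (simp add: ring_center_def)
  have fk: "f k \<in> carrier K.D" using L.coeff_closed[OF fc] .
  have "gen_x \<otimes>\<^bsub>L.D\<^esub> f = f \<otimes>\<^bsub>L.D\<^esub> gen_x"
    using f gen_x_closed by (simp add: ring_center_def)
  then have "K.smono \<one> 1 \<otimes>\<^bsub>K.D\<^esub> f k = f k \<otimes>\<^bsub>K.D\<^esub> K.smono \<one> (2 powi k)"
    unfolding gen_x_mult[OF fc] mult_gen_x[OF fc] by (rule fun_cong)
  then have eq: "f k (q - 1) = f k (q - 2 powi k)" for q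
    using fk K.coeff_closed[OF fk] by (simp add: K_mono_conv K_conv_mono fun_eq_iff)
  show ?thesis
  proof (rule shift_invariant_zero[OF fk, of "1 - 2 powi k"])
    show "1 - 2 powi k \<noteq> (0::rat)" using two_powi_neq_one[OF k] by simp
    show "f k (q + (1 - 2 powi k)) = f k q" for q
      using eq[of "q + 1"] by (simp add: algebra_simps)
  qed
qed

lemma center_eq: "ring_center L.D = const_emb ` carrier R"
proof (intro equalityI subsetI)
  fix f assume f: "f \<in> ring_center L.D"
  have fc: "f \<in> carrier L.D" using f by (simp add: ring_center_def)
  have f0: "f 0 \<in> carrier K.D" using L.coeff_closed[OF fc] .
  have "gen_t 1 \<otimes>\<^bsub>L.D\<^esub> f = f \<otimes>\<^bsub>L.D\<^esub> gen_t 1"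
    using f gen_t_closed by (simp add: ring_center_def)
  \<comment> \<open>The comparison is made at degree 1, to which both products with t move the
    coefficient \<open>f 0\<close>. Being fixed by the dilation, \<open>f 0\<close> is then a
    constant.\<close>
  then have "dilate 1 (f (1 - 1)) = f (1 - 1)"
    unfolding gen_t_mult[OF fc] mult_gen_t[OF fc] by (rule fun_cong)
  then obtain a where a: "a \<in> carrier R" "f 0 = K.smono a 0"
    using dilate_fixed[OF f0] K.coeff_closed[OF f0, of 0] by fastforce
  have "f k = const_emb a k" for k
    using a(2) center_coeff_zero[OF f, of k] by (cases "k = 0") (simp_all add: const_emb_def series_mono_def)
  then have "f = const_emb a" by blast
  then show "f \<in> const_emb ` carrier R" using a(1) by blast
qed (auto simp: const_emb_central)

lemma const_emb_iso: "const_emb \<in> ring_iso R (L.D\<lparr>carrier := ring_center L.D\<rparr>)"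
proof (rule ring_iso_memI)
  show "bij_betw const_emb (carrier R) (carrier (L.D\<lparr>carrier := ring_center L.D\<rparr>))"
    unfolding bij_betw_def center_eq
    by (auto simp: inj_on_def const_emb_def series_mono_def fun_eq_iff split: if_splits)
next
  fix a b assume ab: "a \<in> carrier R" "b \<in> carrier R"
  show "const_emb a \<in> carrier (L.D\<lparr>carrier := ring_center L.D\<rparr>)"
    using ab by (simp add: const_emb_central)
  show "const_emb (a \<otimes> b) = const_emb a \<otimes>\<^bsub>L.D\<lparr>carrier := ring_center L.D\<rparr>\<^esub> const_emb b"
    using ab by (simp add: const_emb_def L.mult_D L.mono_conv_mono L.twist_0 K.mult_D K.mono_conv_mono trivial_twist_def)
  show "const_emb (a \<oplus> b) = const_emb a \<oplus>\<^bsub>L.D\<lparr>carrier := ring_center L.D\<rparr>\<^esub> const_emb b"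
    using ab by (auto simp: const_emb_def L.add_D K.add_D K.zero_D series_mono_def fun_eq_iff)
next
  show "const_emb \<one> = \<one>\<^bsub>L.D\<lparr>carrier := ring_center L.D\<rparr>\<^esub>"
    by (simp add: const_emb_def L.one_D K.one_D)
qed

section \<open>Commutators and factorizations\<close>

lemma commutator_if_coeff_zero:
  assumes f: "f \<in> carrier L.D" and f0: "f 0 = \<zero>\<^bsub>K.D\<^esub>"
  shows "f \<in> ring_commutators L.D"
proof -
  interpret KD: division_ring K.D by (rule K_division_ring)
  have "\<exists>w\<in>carrier K.D. K.smono \<one> 1 \<otimes>\<^bsub>K.D\<^esub> w \<ominus>\<^bsub>K.D\<^esub> w \<otimes>\<^bsub>K.D\<^esub> K.smono \<one> (2 powi k) = h"
    if k: "k \<noteq> 0" and h: "h \<in> carrier K.D" for k h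
  proof -
    \<comment> \<open>The factor x - x^(2^k) that taking the commutator with x puts on the
      coefficient at t^k; it is invertible in \<open>K.D\<close> for
      \<open>k \<noteq> 0\<close>.\<close>
    define v where "v = K.smono \<one> 1 \<ominus>\<^bsub>K.D\<^esub> K.smono \<one> (2 powi k)"
    have v: "v \<in> carrier K.D" by (simp add: v_def)
    have "K.smono \<one> 1 \<noteq> K.smono \<one> (2 powi k :: rat)"
      using two_powi_neq_one[OF k] by (auto simp: series_mono_def fun_eq_iff)
    then have "v \<noteq> \<zero>\<^bsub>K.D\<^esub>" by (simp add: v_def)
    then have "v \<in> Units K.D" using v KD.division_ring_Units by blast
    then have i: "inv\<^bsub>K.D\<^esub> v \<in> carrier K.D" "v \<otimes>\<^bsub>K.D\<^esub> inv\<^bsub>K.D\<^esub> v = \<one>\<^bsub>K.D\<^esub>" by auto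
    define w where "w = inv\<^bsub>K.D\<^esub> v \<otimes>\<^bsub>K.D\<^esub> h"
    have w: "w \<in> carrier K.D" using i h by (simp add: w_def)
    have "w \<otimes>\<^bsub>K.D\<^esub> K.smono \<one> (2 powi k) = K.smono \<one> (2 powi k) \<otimes>\<^bsub>K.D\<^esub> w"
      using w by (simp add: K_mono_conv K_conv_mono)
    then have "K.smono \<one> 1 \<otimes>\<^bsub>K.D\<^esub> w \<ominus>\<^bsub>K.D\<^esub> w \<otimes>\<^bsub>K.D\<^esub> K.smono \<one> (2 powi k) = v \<otimes>\<^bsub>K.D\<^esub> w"
      using w by (simp add: v_def a_minus_def K.D.l_distr K.D.l_minus)
    also have "\<dots> = h"
      using i h v by (simp add: w_def K.D.m_assoc[symmetric])
    finally show ?thesis using w by blast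
  qed
  then obtain w where w: "\<And>k h. k \<noteq> 0 \<Longrightarrow> h \<in> carrier K.D \<Longrightarrow> w k h \<in> carrier K.D"
    "\<And>k h. k \<noteq> 0 \<Longrightarrow> h \<in> carrier K.D \<Longrightarrow>
      K.smono \<one> 1 \<otimes>\<^bsub>K.D\<^esub> w k h \<ominus>\<^bsub>K.D\<^esub> w k h \<otimes>\<^bsub>K.D\<^esub> K.smono \<one> (2 powi k) = h"
    by metis
  note fc = L.coeff_closed[OF f]
  have nz: "k \<noteq> 0" if "f k \<noteq> \<zero>\<^bsub>K.D\<^esub>" for k using that f0 by auto
  \<comment> \<open>The default zero covers degree 0, where no quotient is available, and keeps the
    support of \<open>b\<close> inside that of \<open>f\<close>.\<close>
  define b where "b k = (if f k = \<zero>\<^bsub>K.D\<^esub> then \<zero>\<^bsub>K.D\<^esub> else w k (f k))" for k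
  have b: "b \<in> carrier L.D"
    by (rule L.carrier_DI[OF _ L.supp_in[OF f]])
      (use w(1)[OF nz fc] in \<open>auto simp: b_def support_def\<close>)
  have "gen_x \<otimes>\<^bsub>L.D\<^esub> b \<ominus>\<^bsub>L.D\<^esub> b \<otimes>\<^bsub>L.D\<^esub> gen_x =
      (\<lambda>k. K.smono \<one> 1 \<otimes>\<^bsub>K.D\<^esub> b k \<ominus>\<^bsub>K.D\<^esub> b k \<otimes>\<^bsub>K.D\<^esub> K.smono \<one> (2 powi k))"
    unfolding L.minus_D[OF L.D.m_closed[OF gen_x_closed b] L.D.m_closed[OF b gen_x_closed]]
    unfolding gen_x_mult[OF b] mult_gen_x[OF b] ..
  also have "\<dots> = f"
  proof
    fix k
    show "K.smono \<one> 1 \<otimes>\<^bsub>K.D\<^esub> b k \<ominus>\<^bsub>K.D\<^esub> b k \<otimes>\<^bsub>K.D\<^esub> K.smono \<one> (2 powi k) = f k"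
    proof (cases "f k = \<zero>\<^bsub>K.D\<^esub>")
      case True
      then show ?thesis by (simp add: b_def a_minus_def)
    next
      case False
      then show ?thesis using w(2)[OF nz fc] by (simp add: b_def)
    qed
  qed
  finally show ?thesis using b gen_x_closed unfolding ring_commutators_def by blast
qed

lemma gen_t_commutator: "n \<noteq> 0 \<Longrightarrow> gen_t n \<in> ring_commutators L.D"
  by (rule commutator_if_coeff_zero[OF gen_t_closed]) (simp add: gen_t_def series_mono_def)

lemma gen_t_not_central:
  assumes "n \<noteq> 0"
  shows "gen_t n \<notin> ring_center L.D"
proof
  interpret KD: division_ring K.D by (rule K_division_ring)
  assume "gen_t n \<in> ring_center L.D"
  then have "gen_t n n = \<zero>\<^bsub>K.D\<^esub>" using center_coeff_zero assms by blast
  then show False using KD.one_not_zero by (simp add: gen_t_def series_mono_def)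
qed

lemma product_of_noncentral_commutators:
  assumes f: "f \<in> carrier L.D" "f \<noteq> \<zero>\<^bsub>L.D\<^esub>"
  shows "\<exists>c\<in>ring_commutators L.D - ring_center L.D.
    \<exists>d\<in>ring_commutators L.D - ring_center L.D. f = c \<otimes>\<^bsub>L.D\<^esub> d"
proof -
  have "L.supp f \<noteq> {}" using f(2) by (auto simp: L.zero_D support_def)
  then obtain m where m: "m \<in> L.supp f" "\<And>k. k \<in> L.supp f \<Longrightarrow> m \<le> k"
    using L.supports_Min L.supp_in[OF f(1)] by metis
  \<comment> \<open>Any nonzero \<open>j\<close> below the order \<open>m\<close> of
    \<open>f\<close> serves; \<open>m - 1\<close> fails only for \<open>m = 1\<close>, where it is
    0.\<close>
  define j where "j = (if m = 1 then - 1 else m - 1)"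
  have j: "j < m" "j \<noteq> 0" by (auto simp: j_def)
  define g where "g = f \<otimes>\<^bsub>L.D\<^esub> gen_t (- j)"
  have g: "g \<in> carrier L.D" by (simp add: g_def f gen_t_closed)
  have gk: "g k = f (k + j)" for k by (simp add: g_def mult_gen_t[OF f(1)])
  have "f j = \<zero>\<^bsub>K.D\<^esub>" using m(2)[of j] j by (auto simp: support_def)
  then have "g \<in> ring_commutators L.D" by (intro commutator_if_coeff_zero g) (simp add: gk)
  \<comment> \<open>At the nonzero degree \<open>m - j\<close> the coefficient of \<open>g\<close>
    is the lowest coefficient \<open>f m\<close>.\<close>
  moreover have "g \<notin> ring_center L.D"
    using center_coeff_zero[of g "m - j"] j m(1) by (auto simp: gk support_def)
  moreover have "f = g \<otimes>\<^bsub>L.D\<^esub> gen_t j"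
    using f gen_t_closed by (simp add: g_def L.D.m_assoc gen_t_mult_gen_t gen_t_0)
  ultimately show ?thesis using gen_t_commutator[OF j(2)] gen_t_not_central[OF j(2)] by blast
qed

section \<open>Infinite dimension over the center\<close>

lemma gen_t_independent:
  "L.D.independent (ring_center L.D) (map (\<lambda>i. gen_t (int i)) (rev [0..<n]))"
proof (induction n)
  case 0
  then show ?case by simp
next
  case (Suc n)
  interpret KD: division_ring K.D by (rule K_division_ring)
  let ?Z = "ring_center L.D"
  \<comment> \<open>Central elements are constants and do not move degrees, so a degree at which all
    generators vanish stays zero on their span.\<close>
  have span: "v k = \<zero>\<^bsub>K.D\<^esub>"
    if "v \<in> L.D.Span ?Z us" "set us \<subseteq> carrier L.D" "\<And>u. u \<in> set us \<Longrightarrow> u k = \<zero>\<^bsub>K.D\<^esub>" for v us k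
    using that
  proof (induction us arbitrary: v)
    case Nil
    then show ?case by (simp add: L.zero_D)
  next
    case (Cons u us)
    then obtain z y where z: "z \<in> ?Z" and y: "y \<in> L.D.Span ?Z us"
      and v: "v = z \<otimes>\<^bsub>L.D\<^esub> u \<oplus>\<^bsub>L.D\<^esub> y"
      by (auto simp: L.D.line_extension_mem_iff)
    have yk: "y k = \<zero>\<^bsub>K.D\<^esub>" using Cons.IH[OF y] Cons.prems by auto
    obtain a where a: "a \<in> carrier R" "z = const_emb a" using z center_eq by blast
    have u: "u \<in> carrier L.D" "u k = \<zero>\<^bsub>K.D\<^esub>" using Cons.prems by auto
    have "(z \<otimes>\<^bsub>L.D\<^esub> u) k = K.smono a 0 \<otimes>\<^bsub>K.D\<^esub> u k"
      using u(1) a L.coeff_closed[OF u(1)]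
      by (simp add: const_emb_def L.mult_D L.mono_conv L.twist_0)
    then show ?case using yk u a by (simp add: v L.add_D)
  qed
  have "gen_t (int n) \<notin> L.D.Span ?Z (map (\<lambda>i. gen_t (int i)) (rev [0..<n]))"
  proof
    assume "gen_t (int n) \<in> L.D.Span ?Z (map (\<lambda>i. gen_t (int i)) (rev [0..<n]))"
    then have "gen_t (int n) (int n) = \<zero>\<^bsub>K.D\<^esub>"
      by (rule span) (auto simp: gen_t_closed, auto simp: gen_t_def series_mono_def)
    then show False using KD.one_not_zero by (simp add: gen_t_def series_mono_def)
  qed
  \<comment> \<open>\<open>li_Cons\<close> adds the new vector at the head of the list, and the
    reversed enumeration has \<open>n\<close> in front.\<close>
  then show ?case using L.D.li_Cons[OF gen_t_closed _ Suc.IH] by simp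
qed

text \<open>A finite dimension \<open>n\<close> bounds the length of independent lists, while
  \<open>gen_t_independent\<close> provides one of length \<open>n + 1\<close>.\<close>

lemma infinite_dimension_L: "L.D.infinite_dimension (ring_center L.D) (carrier L.D)"
proof
  interpret LD: division_ring L.D by (rule L_division_ring)
  assume "L.D.finite_dimension (ring_center L.D) (carrier L.D)"
  then obtain n where n: "L.D.dimension n (ring_center L.D) (carrier L.D)" by blast
  have "set (map (\<lambda>i. gen_t (int i)) (rev [0..<Suc n])) \<subseteq> carrier L.D"
    by (auto simp: gen_t_closed)
  then have "length (map (\<lambda>i. gen_t (int i)) (rev [0..<Suc n])) \<le> n"
    by (rule L.D.independent_length_le_dimension[OF LD.ring_center_subfield n gen_t_independent])
  then show False by simp
qed

end

section \<open>Transport along ring isomorphisms\<close>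

context
  fixes R :: "('a, 'm) ring_scheme" and S :: "('b, 'n) ring_scheme" and h :: "'a \<Rightarrow> 'b"
  assumes R: "division_ring R" and S: "ring S" and h: "h \<in> ring_iso R S"
begin

interpretation R: division_ring R by (rule R)
interpretation S: ring S by (rule S)
interpretation h: ring_hom_ring R S h
  by (intro ring_hom_ringI2 R.ring_axioms S) (use h in \<open>simp add: ring_iso_def\<close>)

lemma iso_image: "h ` carrier R = carrier S" and iso_inj: "inj_on h (carrier R)"
  using h by (auto simp: ring_iso_def bij_betw_def)

lemma iso_eq_iff: "x \<in> carrier R \<Longrightarrow> y \<in> carrier R \<Longrightarrow> h x = h y \<longleftrightarrow> x = y"
  using iso_inj by (auto simp: inj_on_def)

lemma iso_division_ring: "division_ring S"
proof (rule S.division_ringI)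
  show "\<one>\<^bsub>S\<^esub> \<noteq> \<zero>\<^bsub>S\<^esub>"
    using R.one_not_zero iso_eq_iff[of "\<one>\<^bsub>R\<^esub>" "\<zero>\<^bsub>R\<^esub>"] by simp
  fix y assume y: "y \<in> carrier S" "y \<noteq> \<zero>\<^bsub>S\<^esub>"
  then obtain x where x: "x \<in> carrier R" "y = h x" using iso_image by blast
  have "x \<noteq> \<zero>\<^bsub>R\<^esub>" using x(2) y(2) h.hom_zero by blast
  then have "x \<in> Units R" using x(1) R.division_ring_Units by blast
  then have "inv\<^bsub>R\<^esub> x \<in> carrier R" "x \<otimes>\<^bsub>R\<^esub> inv\<^bsub>R\<^esub> x = \<one>\<^bsub>R\<^esub>" by auto
  then show "\<exists>z\<in>carrier S. y \<otimes>\<^bsub>S\<^esub> z = \<one>\<^bsub>S\<^esub>"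
    using x h.hom_mult[of x "inv\<^bsub>R\<^esub> x"] h.hom_one
    by (intro bexI[of _ "h (inv\<^bsub>R\<^esub> x)"]) auto
qed

text \<open>Every element of \<open>S\<close> is of the form \<open>h y\<close>, and injectivity of
  \<open>h\<close> reflects the equations that express commuting.\<close>

lemma iso_center: "ring_center S = h ` ring_center R"
proof -
  have "h x \<in> ring_center S \<longleftrightarrow> x \<in> ring_center R" if x: "x \<in> carrier R" for x
  proof -
    have "h x \<otimes>\<^bsub>S\<^esub> h y = h y \<otimes>\<^bsub>S\<^esub> h x \<longleftrightarrow> x \<otimes>\<^bsub>R\<^esub> y = y \<otimes>\<^bsub>R\<^esub> x" if "y \<in> carrier R" for y
      using x that iso_eq_iff[of "x \<otimes>\<^bsub>R\<^esub> y" "y \<otimes>\<^bsub>R\<^esub> x"] by simp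
    then show ?thesis using x by (simp add: ring_center_def iso_image[symmetric])
  qed
  moreover have "ring_center R \<subseteq> carrier R" "ring_center S \<subseteq> h ` carrier R"
    by (auto simp: ring_center_def iso_image)
  ultimately show ?thesis by blast
qed

lemma iso_commutators: "ring_commutators S = h ` ring_commutators R"
proof -
  have "ring_commutators S =
      {h a \<otimes>\<^bsub>S\<^esub> h b \<ominus>\<^bsub>S\<^esub> h b \<otimes>\<^bsub>S\<^esub> h a |a b. a \<in> carrier R \<and> b \<in> carrier R}"
    unfolding ring_commutators_def iso_image[symmetric] by blast
  also have "\<dots> = {h (a \<otimes>\<^bsub>R\<^esub> b \<ominus>\<^bsub>R\<^esub> b \<otimes>\<^bsub>R\<^esub> a) |a b. a \<in> carrier R \<and> b \<in> carrier R}"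
    by (intro Collect_cong ex_cong1 rev_conj_cong refl) (auto simp: a_minus_def)
  also have "\<dots> = h ` ring_commutators R"
    unfolding ring_commutators_def by blast
  finally show ?thesis .
qed

lemma iso_center_ring: "R\<lparr>carrier := ring_center R\<rparr> \<simeq> S\<lparr>carrier := ring_center S\<rparr>"
proof -
  have "ring_center R \<subseteq> carrier R" by (auto simp: ring_center_def)
  then have "h \<in> ring_iso (R\<lparr>carrier := ring_center R\<rparr>) (S\<lparr>carrier := ring_center S\<rparr>)"
    using inj_on_subset[OF iso_inj]
    by (intro ring_iso_memI) (auto simp: iso_center bij_betw_def subset_iff)
  then show ?thesis by (auto simp: is_ring_iso_def)
qed

lemma iso_infinite_dimension:
  assumes "R.infinite_dimension (ring_center R) (carrier R)"
  shows "S.infinite_dimension (ring_center S) (carrier S)"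
proof -
  interpret S': division_ring S by (rule iso_division_ring)
  have "S.infinite_dimension (h ` ring_center R) (h ` carrier R)"
    using assms iso_inj S'.one_not_zero subfieldE(3)[OF R.ring_center_subfield]
    by (intro h.infinite_dimension_hom R.ring_center_subfield R.carrier_is_subalgebra) auto
  then show ?thesis by (simp add: iso_center iso_image)
qed

text \<open>Injectivity keeps noncentral commutators noncentral, and multiplicativity carries the
  factorization over.\<close>

lemma iso_commutator_product:
  assumes x: "x \<in> carrier R"
    and "\<exists>c\<in>ring_commutators R - ring_center R. \<exists>d\<in>ring_commutators R - ring_center R. x = c \<otimes>\<^bsub>R\<^esub> d"
  shows "\<exists>c\<in>ring_commutators S - ring_center S. \<exists>d\<in>ring_commutators S - ring_center S. h x = c \<otimes>\<^bsub>S\<^esub> d"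
proof -
  have sub: "ring_commutators R \<subseteq> carrier R" "ring_center R \<subseteq> carrier R"
    by (auto simp: ring_commutators_def ring_center_def)
  have img: "h c \<in> ring_commutators S - ring_center S" if "c \<in> ring_commutators R - ring_center R" for c
    using that sub iso_eq_iff unfolding iso_center iso_commutators by blast
  obtain c d where "c \<in> ring_commutators R - ring_center R" "d \<in> ring_commutators R - ring_center R"
    and "x = c \<otimes>\<^bsub>R\<^esub> d" using assms(2) by blast
  moreover from this have "h x = h c \<otimes>\<^bsub>S\<^esub> h d" using sub by (simp add: subset_iff)
  ultimately show ?thesis using img by blast
qed

end

theorem theorem22:
  fixes F :: "('a, 'm) ring_scheme"
  assumes "field F"
  shows "\<exists>D :: (nat \<Rightarrow> 'a) ring.
    division_ring D
    \<and> (\<exists>a\<in>carrier D. \<exists>b\<in>carrier D. a \<otimes>\<^bsub>D\<^esub> b \<noteq> b \<otimes>\<^bsub>D\<^esub> a)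
    \<and> F \<simeq> D\<lparr>carrier := ring_center D\<rparr>
    \<and> ring.infinite_dimension D (ring_center D) (carrier D)
    \<and> (\<forall>x\<in>carrier D. \<exists>c\<in>ring_commutators D. \<exists>d\<in>ring_commutators D. x = c \<otimes>\<^bsub>D\<^esub> d)
    \<and> (\<forall>x\<in>carrier D - {\<zero>\<^bsub>D\<^esub>}.
         \<exists>c\<in>ring_commutators D - ring_center D.
           \<exists>d\<in>ring_commutators D - ring_center D. x = c \<otimes>\<^bsub>D\<^esub> d)"
proof -
  interpret F: field F by fact
  \<comment> \<open>The coefficients are indexed by pairs in \<open>int \<times> rat\<close>, a
    countable type; reading the pairs through \<open>from_nat\<close> codes a series as a function
    on \<open>nat\<close>, as the statement asks. Each pair is reached from its
    \<open>to_nat\<close> code, so no coefficient is lost.\<close>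
  define h :: "(int \<Rightarrow> rat \<Rightarrow> 'a) \<Rightarrow> nat \<Rightarrow> 'a"
    where "h f = (\<lambda>n. case_prod f (from_nat n))" for f
  have "inj h"
  proof (rule injI, intro ext)
    fix f g :: "int \<Rightarrow> rat \<Rightarrow> 'a" and i :: int and q :: rat
    assume "h f = h g"
    then have "h f (to_nat (i, q)) = h g (to_nat (i, q))" by simp
    then show "f i q = g i q" by (simp add: h_def)
  qed
  then have inj: "inj_on h (carrier F.L.D)" by (rule inj_on_subset) simp
  define D where "D = image_ring h F.L.D"
  have h: "h \<in> ring_iso F.L.D D"
    unfolding D_def by (rule inj_imp_image_ring_iso[OF inj])
  interpret D: ring D
    unfolding D_def by (rule F.L.D.inj_imp_image_ring_is_ring[OF inj])
  note iso = F.L_division_ring D.ring_axioms h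
  interpret D: division_ring D by (rule iso_division_ring[OF iso])
  note transfer = iso_image[OF iso] iso_center[OF iso] iso_commutators[OF iso]
  have zero: "h \<zero>\<^bsub>F.L.D\<^esub> = \<zero>\<^bsub>D\<^esub>"
    unfolding D_def image_ring_zero ..
  have nonzero: "\<exists>c\<in>ring_commutators D - ring_center D.
      \<exists>d\<in>ring_commutators D - ring_center D. y = c \<otimes>\<^bsub>D\<^esub> d"
    if "y \<in> carrier D - {\<zero>\<^bsub>D\<^esub>}" for y
  proof -
    have "y \<in> h ` carrier F.L.D" using that by (simp add: transfer(1))
    then obtain x where x: "x \<in> carrier F.L.D" "y = h x" by blast
    then have "x \<noteq> \<zero>\<^bsub>F.L.D\<^esub>" using that zero by auto
    then show ?thesis
      unfolding x(2)
      by (intro iso_commutator_product[OF iso x(1)] F.product_of_noncentral_commutators x(1))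
  qed
  \<comment> \<open>Zero is outside the scope of \<open>nonzero\<close>; it is the product of the
    commutator [0, 0] with itself.\<close>
  have "\<zero>\<^bsub>D\<^esub> \<in> ring_commutators D"
    unfolding ring_commutators_def by (auto simp: D.r_neg a_minus_def intro!: exI[of _ "\<zero>\<^bsub>D\<^esub>"])
  moreover have "\<zero>\<^bsub>D\<^esub> = \<zero>\<^bsub>D\<^esub> \<otimes>\<^bsub>D\<^esub> \<zero>\<^bsub>D\<^esub>" by simp
  ultimately have all: "\<exists>c\<in>ring_commutators D. \<exists>d\<in>ring_commutators D. y = c \<otimes>\<^bsub>D\<^esub> d"
    if "y \<in> carrier D" for y
    using that nonzero[of y] by (cases "y = \<zero>\<^bsub>D\<^esub>") blast+
  \<comment> \<open>A factor of one obtained from \<open>nonzero\<close> is noncentral, hence fails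
    to commute with some element.\<close>
  have "\<one>\<^bsub>D\<^esub> \<in> carrier D - {\<zero>\<^bsub>D\<^esub>}" using D.one_not_zero by simp
  then obtain c where "c \<in> ring_commutators D - ring_center D" using nonzero by blast
  then have noncomm: "\<exists>a\<in>carrier D. \<exists>b\<in>carrier D. a \<otimes>\<^bsub>D\<^esub> b \<noteq> b \<otimes>\<^bsub>D\<^esub> a"
    by (auto simp: ring_commutators_def ring_center_def)
  have "F \<simeq> F.L.D\<lparr>carrier := ring_center F.L.D\<rparr>"
    using F.const_emb_iso by (auto simp: is_ring_iso_def)
  then have "F \<simeq> D\<lparr>carrier := ring_center D\<rparr>"
    using iso_center_ring[OF iso] ring_iso_trans by blast
  moreover have "D.infinite_dimension (ring_center D) (carrier D)"
    by (rule iso_infinite_dimension[OF iso F.infinite_dimension_L])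
  ultimately show ?thesis
    using D.division_ring_axioms noncomm nonzero all by blast
qed

end
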